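(* Let $m \in \mathbb{N}$ and let $N_1,\dots,N_m, nv_m, dv_m, snv_m, sdv_m \in \mathbb{N}$ satisfy $$\begin{bmatrix} nv_m & snv_m\\ dv_m & sdv_m \end{bmatrix} = \begin{bmatrix} 0 & 1\\ 1 & 0 \end{bmatrix} \prod_{k=1}^{m} \begin{bmatrix} 1 & 1\\ N_k & N_k+1 \end{bmatrix}.$$ Then $$\frac{nv_m}{dv_m} < \frac{snv_m}{sdv_m}.$$
   Context: $\mathbb{N}$ denotes the positive integers. The product $\prod_{k=1}^m M_k$ of $2\times 2$ matrices is taken in the order $M_1 M_2 \cdots M_m$. (Interpretation: $nv_m/dv_m$ is the rational key of the tree node at position $[\circ N_1 \circ \cdots \circ N_m]$, i.e. the $N_m$-th child of the $\dots$ of the $N_1$-th top-level node, and $snv_m/sdv_m$ is the rational key of its next sibling.) *)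

theory Defs
  imports "HOL-Analysis.Analysis"
begin

text \<open>The row-major matrix with rows \<open>(a, b)\<close> and \<open>(c, d)\<close>.\<close>

abbreviation mat2x2 :: "'a::zero \<Rightarrow> 'a \<Rightarrow> 'a \<Rightarrow> 'a \<Rightarrow> 'a ^ 2 ^ 2" where
  "mat2x2 a b c d \<equiv> vector [vector [a, b], vector [c, d]]"

text \<open>The ordered product \<open>M 1 ** M 2 ** \<dots> ** M m\<close>. It cannot be written with the library's
  \<open>prod\<close> or \<open>prod_list\<close>, since \<open>**\<close> is not the multiplication of the type class instance on
  vectors (which is componentwise).\<close>

primrec matrix_prod :: "(nat \<Rightarrow> 'a::semiring_1 ^ 'n ^ 'n) \<Rightarrow> nat \<Rightarrow> 'a ^ 'n ^ 'n" where
  "matrix_prod M 0 = mat 1"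
| "matrix_prod M (Suc m) = matrix_prod M m ** M (Suc m)"

end

theory Submission
  imports Defs
begin

text \<open>Each factor has determinant 1 and the leading swap has determinant \<open>-1\<close>, so
  \<open>snv * dv - nv * sdv = 1\<close>, which is positive. Since the entries are natural numbers, the
  determinant identities are stated without subtraction.\<close>

lemma matrix_prod_det_one:
  fixes N :: "nat \<Rightarrow> nat"
  defines "P \<equiv> matrix_prod (\<lambda>k. mat2x2 1 1 (N k) (N k + 1))"
  shows "P m $ 1 $ 1 * P m $ 2 $ 2 = P m $ 1 $ 2 * P m $ 2 $ 1 + 1"
proof (induction m)
  case 0
  show ?case by (simp add: P_def mat_def)
next
  case (Suc m)
  \<comment> \<open>With \<open>a b c d\<close> the entries of \<open>P m\<close> and
    \<open>n = N (Suc m)\<close>, both sides expand to sums sharing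
    \<open>a*c + a*d*n + b*c*n + b*d*n*(n+1)\<close>; cancelling it leaves the induction hypothesis
    \<open>a*d = b*c + 1\<close>.\<close>
  then show ?case
    by (simp add: P_def matrix_matrix_mult_def sum_2 algebra_simps)
qed

theorem theorem4p4:
  fixes m nv dv snv sdv :: nat and N :: "nat \<Rightarrow> nat"
  assumes "m \<ge> 1"
    and "\<And>k. k \<in> {1..m} \<Longrightarrow> N k \<ge> 1"
    and "nv \<ge> 1" and "dv \<ge> 1" and "snv \<ge> 1" and "sdv \<ge> 1"
    and "mat2x2 nv snv dv sdv =
           mat2x2 0 1 1 0 ** matrix_prod (\<lambda>k. mat2x2 1 1 (N k) (N k + 1)) m"
  shows "(of_nat nv / of_nat dv :: rat) < of_nat snv / of_nat sdv"
proof -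
  define P where "P = matrix_prod (\<lambda>k. mat2x2 1 1 (N k) (N k + 1)) m"
  have eq: "mat2x2 nv snv dv sdv $ i $ j = (mat2x2 0 1 1 0 ** P) $ i $ j" for i j
    using assms(7) by (simp add: P_def)
  \<comment> \<open>Left multiplication by the swap matrix exchanges the rows of \<open>P\<close>,
    so numerators come from row 2 and denominators from row 1.\<close>
  have "nv = P $ 2 $ 1" "snv = P $ 2 $ 2" "dv = P $ 1 $ 1" "sdv = P $ 1 $ 2"
    using eq[of 1 1] eq[of 1 2] eq[of 2 1] eq[of 2 2]
    by (simp_all add: matrix_matrix_mult_def sum_2)
  then have "nv * sdv < snv * dv"
    using matrix_prod_det_one[of N m] by (simp add: P_def mult.commute)
  then have "(of_nat nv * of_nat sdv :: rat) < of_nat snv * of_nat dv"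
    by (metis of_nat_less_iff of_nat_mult)
  then show ?thesis
    \<comment> \<open>Both denominators are positive, so cross-multiplication preserves the
      direction of the inequality.\<close>
    using assms(4,6) by (simp add: field_simps)
qed

end
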